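(* Let $X$ be a weighted graph on $n$ vertices containing a vertex $u$ that has a twin, and let $M\in\{A(X),L(X),Q(X)\}$. If local $\epsilon$-uniform mixing occurs at $u$ in $X$ relative to $M$, then $n\le 4$.
   Context: Graphs are finite, simple, undirected and connected, with positive real edge weights. $A(X)$ is the weighted adjacency matrix, $D(X)$ is the diagonal matrix of vertex degrees (degree = sum of weights of incident edges), $L(X)=D(X)-A(X)$, $Q(X)=D(X)+A(X)$, and $U(t)=e^{\mathrm{i}tM}$. $\mathbf{e}_u$ is the characteristic vector of $u$, $\mathbf{1}$ the all-ones vector, $\circ$ the entrywise product. Local $\epsilon$-uniform mixing occurs at $u$ relative to $M$ if for each $\epsilon>0$ there is a time $\tau\in\mathbb{R}$ such that $\big\|(U(\tau)\mathbf{e}_u)\circ(\overline{U(\tau)}\mathbf{e}_u)-\tfrac1n\mathbf{1}\big\|<\epsilon$. Two distinct vertices $u$ and $v$ (adjacent or not) are twins in $X$ if $N(u)\setminus\{v\}=N(v)\setminus\{u\}$, where $N(\cdot)$ denotes the neighborhood, and the edges $\{u,w\}$ and $\{v,w\}$ have equal weights for all $w\in V(X)\setminus\{u,v\}$ adjacent to $u$ and $v$. *)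

theory Defs
  imports "HOL-Analysis.Analysis"
begin

text \<open>The vertex set is the whole finite type \<open>'n\<close>, so the graph has \<open>CARD('n)\<close> vertices.
  The values of \<open>w\<close> on non-adjacent pairs carry no meaning.\<close>

locale weighted_graph =
  fixes E :: "'n::finite \<Rightarrow> 'n \<Rightarrow> bool" and w :: "'n \<Rightarrow> 'n \<Rightarrow> real"
  assumes irrefl: "\<not> E u u"
    and sym: "E u v \<Longrightarrow> E v u"
    and weight_sym: "E u v \<Longrightarrow> w u v = w v u"
    and weight_pos: "E u v \<Longrightarrow> 0 < w u v"
    and connected: "E\<^sup>*\<^sup>* u v"

definition nbhd :: "('n \<Rightarrow> 'n \<Rightarrow> bool) \<Rightarrow> 'n \<Rightarrow> 'n set" where
  "nbhd E u = {v. E u v}"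

definition wdegree :: "('n::finite \<Rightarrow> 'n \<Rightarrow> bool) \<Rightarrow> ('n \<Rightarrow> 'n \<Rightarrow> real) \<Rightarrow> 'n \<Rightarrow> real" where
  "wdegree E w u = (\<Sum>v\<in>nbhd E u. w u v)"

definition adj_mat :: "('n::finite \<Rightarrow> 'n \<Rightarrow> bool) \<Rightarrow> ('n \<Rightarrow> 'n \<Rightarrow> real) \<Rightarrow> real^'n^'n" where
  "adj_mat E w = (\<chi> u v. if E u v then w u v else 0)"

definition deg_mat :: "('n::finite \<Rightarrow> 'n \<Rightarrow> bool) \<Rightarrow> ('n \<Rightarrow> 'n \<Rightarrow> real) \<Rightarrow> real^'n^'n" where
  "deg_mat E w = (\<chi> u v. if u = v then wdegree E w u else 0)"

definition lap_mat :: "('n::finite \<Rightarrow> 'n \<Rightarrow> bool) \<Rightarrow> ('n \<Rightarrow> 'n \<Rightarrow> real) \<Rightarrow> real^'n^'n" where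
  "lap_mat E w = deg_mat E w - adj_mat E w"

definition signless_lap_mat :: "('n::finite \<Rightarrow> 'n \<Rightarrow> bool) \<Rightarrow> ('n \<Rightarrow> 'n \<Rightarrow> real) \<Rightarrow> real^'n^'n" where
  "signless_lap_mat E w = deg_mat E w + adj_mat E w"

definition twins :: "('n \<Rightarrow> 'n \<Rightarrow> bool) \<Rightarrow> ('n \<Rightarrow> 'n \<Rightarrow> real) \<Rightarrow> 'n \<Rightarrow> 'n \<Rightarrow> bool" where
  "twins E w u v \<longleftrightarrow> u \<noteq> v \<and> nbhd E u - {v} = nbhd E v - {u} \<and>
     (\<forall>x. x \<notin> {u, v} \<and> E u x \<and> E v x \<longrightarrow> w u x = w v x)"

text \<open>Multiplication, powers and \<open>1\<close> on the type \<^typ>\<open>complex^'n^'n\<close> are entrywise, so \<open>exp\<close> and \<open>^\<close>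
  cannot be used for matrices; the exponential is its power series with respect to \<open>**\<close>.\<close>

definition mat_exp :: "complex^'n^'n \<Rightarrow> complex^'n^'n" where
  "mat_exp B = (\<Sum>k. (1 / fact k) *\<^sub>R (((**) B ^^ k) (mat 1)))"

definition transition_mat :: "real^'n^'n \<Rightarrow> real \<Rightarrow> complex^'n^'n" where
  "transition_mat M t = mat_exp (map_matrix (\<lambda>x. \<i> * complex_of_real t * complex_of_real x) M)"

text \<open>On vectors, \<open>*\<close> is the entrywise product and \<open>1\<close> the all-ones vector; \<open>axis u 1\<close> is the
  characteristic vector of \<open>u\<close>.\<close>

definition local_eps_uniform_mixing :: "real^'n^'n \<Rightarrow> 'n \<Rightarrow> bool" where
  "local_eps_uniform_mixing M u \<longleftrightarrow>
     (\<forall>\<epsilon>>0. \<exists>\<tau>::real.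
        norm ((transition_mat M \<tau> *v axis u 1) * (map_matrix cnj (transition_mat M \<tau>) *v axis u 1)
              - (1 / real CARD('n)) *\<^sub>R 1) < \<epsilon>)"

end

theory Submission
  imports Defs
begin

text \<open>If \<open>u\<close> and \<open>v\<close> are twins, then \<open>e\<^sub>u - e\<^sub>v\<close> is a left eigenvector of \<open>M\<close> with a real eigenvalue
  \<open>\<theta>\<close>. Comparing the \<open>u\<close>-th coordinates of \<open>(e\<^sub>u - e\<^sub>v)\<^sup>T U(t) = e\<^sup>i\<^sup>t\<^sup>\<theta> (e\<^sub>u - e\<^sub>v)\<^sup>T\<close> shows that the
  entries \<open>a = U(t)\<^sub>u\<^sub>u\<close> and \<open>b = U(t)\<^sub>v\<^sub>u\<close> differ by a number of modulus 1, so
  \<open>1 \<le> (|a| + |b|)\<^sup>2 \<le> 2 (|a|\<^sup>2 + |b|\<^sup>2)\<close>. Mixing makes the right-hand side arbitrarily close to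
  \<open>4 / n\<close>.\<close>

text \<open>The sum of the norms of all entries of \<open>B\<close> dominates every row sum, so each
  further factor \<open>B\<close> costs at most that constant. This supplies the majorant for the
  exponential series.\<close>

lemma norm_matrix_power_entry_le:
  fixes B :: "complex^'n^'n"
  shows "norm ((((**) B ^^ k) (mat 1)) $ i $ j) \<le> (\<Sum>p\<in>UNIV. \<Sum>q\<in>UNIV. norm (B $ p $ q)) ^ k"
proof (induction k arbitrary: i)
  case 0
  then show ?case by (simp add: mat_def)
next
  case (Suc k)
  define b where "b = (\<Sum>p\<in>UNIV. \<Sum>q\<in>UNIV. norm (B $ p $ q))"
  define P where "P = ((**) B ^^ k) (mat 1)"
  have b0: "0 \<le> b" by (simp add: b_def sum_nonneg)
  have IH: "norm (P $ q $ j) \<le> b ^ k" for q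
    using Suc.IH by (simp add: P_def b_def)
  have "norm (\<Sum>q\<in>UNIV. B $ i $ q * P $ q $ j) \<le> (\<Sum>q\<in>UNIV. norm (B $ i $ q) * b ^ k)"
    by (rule sum_norm_le) (simp add: norm_mult mult_left_mono IH)
  also have "\<dots> = (\<Sum>q\<in>UNIV. norm (B $ i $ q)) * b ^ k"
    by (simp add: sum_distrib_right)
  also have "\<dots> \<le> b * b ^ k"
  proof (rule mult_right_mono)
    show "(\<Sum>q\<in>UNIV. norm (B $ i $ q)) \<le> b"
      unfolding b_def
      by (rule member_le_sum[where f = "\<lambda>p. \<Sum>q\<in>UNIV. norm (B $ p $ q)"]) (auto intro: sum_nonneg)
  qed (simp add: b0)
  also have "(\<Sum>q\<in>UNIV. B $ i $ q * P $ q $ j) = (((**) B ^^ Suc k) (mat 1)) $ i $ j"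
    by (simp add: matrix_matrix_mult_def[of B P] flip: P_def)
  finally show ?case
    by (simp add: b_def)
qed

text \<open>Comparison with a multiple of the scalar exponential series. Convergence is what lets
  linear functionals pass through \<open>suminf\<close> in \<open>mat_exp\<close>.\<close>

lemma summable_mat_exp:
  fixes B :: "complex^'n^'n"
  shows "summable (\<lambda>k. (1 / fact k) *\<^sub>R (((**) B ^^ k) (mat 1)))"
proof -
  define b where "b = (\<Sum>p\<in>UNIV. \<Sum>q\<in>UNIV. norm (B $ p $ q))"
  \<comment> \<open>\<open>c\<close> counts the entries: the norm of a matrix is at most the sum of
    the norms of its entries, each bounded by \<open>b ^ k\<close>.\<close>
  define c where "c = real CARD('n) * real CARD('n)"
  have "norm ((1 / fact k) *\<^sub>R (((**) B ^^ k) (mat 1))) \<le> c * (b ^ k /\<^sub>R fact k)" for k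
  proof -
    define P where "P = ((**) B ^^ k) (mat 1)"
    have "norm P \<le> (\<Sum>i\<in>UNIV. norm (P $ i))"
      unfolding norm_vec_def by (rule L2_set_le_sum) simp
    also have "\<dots> \<le> (\<Sum>i\<in>(UNIV::'n set). \<Sum>j\<in>(UNIV::'n set). norm (P $ i $ j))"
      by (intro sum_mono) (simp add: norm_vec_def L2_set_le_sum)
    also have "\<dots> \<le> (\<Sum>i\<in>(UNIV::'n set). \<Sum>j\<in>(UNIV::'n set). b ^ k)"
      unfolding P_def b_def by (intro sum_mono norm_matrix_power_entry_le)
    finally have "norm P \<le> c * b ^ k" by (simp add: c_def mult.assoc)
    then show ?thesis
      by (simp add: P_def divide_simps)
  qed
  then show ?thesis
    by (intro summable_comparison_test[OF _ summable_mult[OF summable_exp_generic]]) blast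
qed

text \<open>The rows of \<open>mat 1\<close> are the unit vectors, so \<open>eig\<close> makes
  \<open>e_u - e_v\<close> a left eigenvector of \<open>B\<close>. Then \<open>B^k\<close> has
  eigenvalue \<open>\<mu> ^ k\<close> on it, and summing the series gives
  \<open>exp \<mu>\<close>.\<close>

lemma mat_exp_row_diff:
  fixes B :: "complex^'n^'n"
  assumes eig: "\<And>j. B $ u $ j - B $ v $ j = \<mu> * (mat 1 $ u $ j - mat 1 $ v $ j)"
  shows "mat_exp B $ u $ j - mat_exp B $ v $ j = exp \<mu> * (mat 1 $ u $ j - mat 1 $ v $ j)"
proof -
  define d :: complex where "d = mat 1 $ u $ j - mat 1 $ v $ j"
  define P where "P = (\<lambda>k. ((**) B ^^ k) (mat 1))"
  have pow: "P k $ u $ j - P k $ v $ j = \<mu> ^ k * d" for k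
  proof (induction k)
    case 0
    then show ?case by (simp add: P_def d_def)
  next
    case (Suc k)
    have "P (Suc k) $ u $ j - P (Suc k) $ v $ j = (\<Sum>q\<in>UNIV. (B $ u $ q - B $ v $ q) * P k $ q $ j)"
      by (simp add: P_def matrix_matrix_mult_def sum_subtractf left_diff_distrib)
    \<comment> \<open>The new factor \<open>B\<close> stands on the left, so \<open>eig\<close>
      applies to it directly and leaves rows of \<open>mat 1 ** P k\<close>, that is, of
      \<open>P k\<close>.\<close>
    also have "\<dots> = \<mu> * ((\<Sum>q\<in>UNIV. mat 1 $ u $ q * P k $ q $ j)
        - (\<Sum>q\<in>UNIV. mat 1 $ v $ q * P k $ q $ j))"
      by (simp add: eig sum_distrib_left sum_subtractf algebra_simps)
    also have "\<dots> = \<mu> * ((mat 1 ** P k) $ u $ j - (mat 1 ** P k) $ v $ j)"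
      by (simp add: matrix_matrix_mult_def)
    finally show ?case by (simp add: Suc)
  qed
  have "bounded_linear (\<lambda>X::complex^'n^'n. X $ u $ j - X $ v $ j)"
    by (intro bounded_linear_sub bounded_linear_compose[OF bounded_linear_vec_nth]
        bounded_linear_vec_nth)
  from bounded_linear.suminf[OF this summable_mat_exp[of B]]
  have "mat_exp B $ u $ j - mat_exp B $ v $ j
      = (\<Sum>k. (1 / fact k) *\<^sub>R (P k $ u $ j - P k $ v $ j))"
    by (simp add: mat_exp_def P_def scaleR_diff_right)
  also have "\<dots> = (\<Sum>k. (\<mu> ^ k /\<^sub>R fact k) * d)"
    by (simp add: pow divide_inverse)
  also have "\<dots> = exp \<mu> * d"
    by (simp add: exp_def suminf_mult2[OF summable_exp_generic])
  finally show ?thesis by (simp add: d_def)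
qed

lemma twins_adj_mat_eq:
  assumes "twins E w u v" "j \<noteq> u" "j \<noteq> v"
  shows "adj_mat E w $ u $ j = adj_mat E w $ v $ j"
  using assms by (auto simp: twins_def nbhd_def adj_mat_def)

lemma adj_mat_sym:
  assumes "weighted_graph E w"
  shows "adj_mat E w $ i $ j = adj_mat E w $ j $ i"
  using weighted_graph.sym[OF assms] weighted_graph.weight_sym[OF assms]
  by (auto simp: adj_mat_def)

lemma adj_mat_diag:
  assumes "weighted_graph E w"
  shows "adj_mat E w $ i $ i = 0"
  using weighted_graph.irrefl[OF assms] by (simp add: adj_mat_def)

lemma wdegree_eq_sum_adj_mat: "wdegree E w i = (\<Sum>j\<in>UNIV. adj_mat E w $ i $ j)"
  by (simp add: wdegree_def nbhd_def adj_mat_def sum.If_cases)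

text \<open>The two adjacency rows agree off \<open>{u, v}\<close>; on it each contributes only the
  entry for the pair, which is symmetric.\<close>

lemma twins_wdegree_eq:
  assumes "weighted_graph E w" "twins E w u v"
  shows "wdegree E w u = wdegree E w v"
proof -
  have uv: "u \<noteq> v" using assms(2) by (simp add: twins_def)
  have split: "sum f UNIV = f u + f v + sum f (UNIV - {u, v})" for f :: "'a \<Rightarrow> real"
    using sum.subset_diff[of "{u, v}" UNIV f] uv by simp
  have "(\<Sum>j\<in>UNIV - {u, v}. adj_mat E w $ u $ j) = (\<Sum>j\<in>UNIV - {u, v}. adj_mat E w $ v $ j)"
    using twins_adj_mat_eq[OF assms(2)] by (intro sum.cong) auto
  then show ?thesis
    using adj_mat_sym[OF assms(1), of u v]
    by (simp add: wdegree_eq_sum_adj_mat split adj_mat_diag[OF assms(1)])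
qed

text \<open>With \<open>d\<close> the common degree and \<open>a\<close> the adjacency entry at
  \<open>u\<close>, \<open>v\<close> (0 if they are not adjacent), the eigenvalues are
  \<open>-a\<close>, \<open>d + a\<close> and \<open>d - a\<close> for the three matrices.\<close>

lemma twins_left_eigenvector:
  assumes "weighted_graph E w" and tw: "twins E w u v"
    and "M \<in> {adj_mat E w, lap_mat E w, signless_lap_mat E w}"
  obtains \<theta> where "\<And>j. M $ u $ j - M $ v $ j = \<theta> * (mat 1 $ u $ j - mat 1 $ v $ j)"
proof -
  have uv: "u \<noteq> v" using tw by (simp add: twins_def)
  have A: "adj_mat E w $ u $ j - adj_mat E w $ v $ j
      = - adj_mat E w $ u $ v * (mat 1 $ u $ j - mat 1 $ v $ j)" for j
    using uv twins_adj_mat_eq[OF tw, of j] adj_mat_sym[OF assms(1), of u v]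
      adj_mat_diag[OF assms(1)]
    by (cases "j = u"; cases "j = v") (auto simp: mat_def)
  have D: "deg_mat E w $ u $ j - deg_mat E w $ v $ j
      = wdegree E w u * (mat 1 $ u $ j - mat 1 $ v $ j)" for j
    using twins_wdegree_eq[OF assms(1) tw] by (auto simp: deg_mat_def mat_def)
  consider "M = adj_mat E w" | "M = lap_mat E w" | "M = signless_lap_mat E w"
    using assms(3) by blast
  then show ?thesis
  proof cases
    case 1
    show ?thesis using A by (intro that[of "- adj_mat E w $ u $ v"]) (simp only: 1)
  next
    case 2
    have "M $ u $ j - M $ v $ j
        = (wdegree E w u + adj_mat E w $ u $ v) * (mat 1 $ u $ j - mat 1 $ v $ j)" for j
      using A[of j] D[of j] by (simp add: 2 lap_mat_def algebra_simps)
    then show ?thesis by (rule that)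
  next
    case 3
    have "M $ u $ j - M $ v $ j
        = (wdegree E w u - adj_mat E w $ u $ v) * (mat 1 $ u $ j - mat 1 $ v $ j)" for j
      using A[of j] D[of j] by (simp add: 3 signless_lap_mat_def algebra_simps)
    then show ?thesis by (rule that)
  qed
qed

lemma norm_transition_mat_twins_diff:
  assumes "u \<noteq> v"
    and eig: "\<And>j. M $ u $ j - M $ v $ j = \<theta> * (mat 1 $ u $ j - mat 1 $ v $ j)"
  shows "norm (transition_mat M t $ u $ u - transition_mat M t $ v $ u) = 1"
proof -
  define B where "B = map_matrix (\<lambda>x. \<i> * complex_of_real t * complex_of_real x) M"
  have "B $ u $ j - B $ v $ j = \<i> * of_real (t * \<theta>) * (mat 1 $ u $ j - mat 1 $ v $ j)" for j
  proof -
    have "B $ u $ j - B $ v $ j = \<i> * of_real t * of_real (M $ u $ j - M $ v $ j)"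
      by (simp add: B_def map_matrix_def algebra_simps)
    then show ?thesis
      unfolding eig by (simp add: mat_def)
  qed
  \<comment> \<open>The eigenvalue is purely imaginary because \<open>\<theta>\<close> is real, so
    its exponential has modulus 1; in column \<open>u\<close> the remaining factor is 1.\<close>
  from mat_exp_row_diff[of B, OF this, of u] show ?thesis
    using assms(1) by (simp add: transition_mat_def B_def[symmetric] mat_def)
qed

text \<open>Coordinate \<open>i\<close> of the vector in the assumption is the real number
  \<open>|U_iu|^2 - 1/n\<close>, and a coordinate is bounded by the norm.\<close>

lemma norm_square_transition_mat_close:
  fixes M :: "real^'n^'n"
  assumes "norm ((transition_mat M t *v axis u 1) * (map_matrix cnj (transition_mat M t) *v axis u 1)
              - (1 / real CARD('n)) *\<^sub>R 1) < \<epsilon>"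
  shows "(norm (transition_mat M t $ i $ u))\<^sup>2 < 1 / real CARD('n) + \<epsilon>"
proof -
  let ?a = "transition_mat M t $ i $ u"
  let ?x = "(transition_mat M t *v axis u 1) * (map_matrix cnj (transition_mat M t) *v axis u 1)
              - (1 / real CARD('n)) *\<^sub>R 1"
  have col: "(A *v axis u 1) $ i = A $ i $ u" for A :: "complex^'n^'n"
    by (simp add: matrix_vector_mult_def axis_def if_distrib cong: if_cong)
  have "?x $ i = ?a * cnj ?a - of_real (1 / real CARD('n))"
    unfolding vector_minus_component vector_mult_component vector_scaleR_component one_index col
    by (simp add: map_matrix_def scaleR_conv_of_real)
  also have "\<dots> = of_real ((norm ?a)\<^sup>2 - 1 / real CARD('n))"
    by (simp add: complex_norm_square[symmetric])
  finally have "norm (?x $ i) = \<bar>(norm ?a)\<^sup>2 - 1 / real CARD('n)\<bar>"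
    by (simp only: norm_of_real)
  moreover have "norm (?x $ i) < \<epsilon>"
    using Finite_Cartesian_Product.norm_nth_le[of ?x i] assms by (meson le_less_trans)
  ultimately show ?thesis by linarith
qed

theorem corollary12:
  fixes E :: "'n::finite \<Rightarrow> 'n \<Rightarrow> bool" and w :: "'n \<Rightarrow> 'n \<Rightarrow> real"
    and u :: 'n and M :: "real^'n^'n"
  assumes "weighted_graph E w"
    and "\<exists>v. twins E w u v"
    and "M \<in> {adj_mat E w, lap_mat E w, signless_lap_mat E w}"
    and "local_eps_uniform_mixing M u"
  shows "CARD('n) \<le> 4"
proof -
  obtain v where tw: "twins E w u v" using assms(2) by blast
  then have uv: "u \<noteq> v" by (simp add: twins_def)
  obtain \<theta> where eig: "\<And>j. M $ u $ j - M $ v $ j = \<theta> * (mat 1 $ u $ j - mat 1 $ v $ j)"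
    using twins_left_eigenvector[OF assms(1) tw assms(3)] by blast
  \<comment> \<open>Mixing is only approximate, so the bound is first proved with arbitrary
    slack.\<close>
  have "1 \<le> 4 / real CARD('n) + \<epsilon>" if "0 < \<epsilon>" for \<epsilon>
  proof -
    \<comment> \<open>Two squared moduli, each off by less than \<open>\<epsilon> / 4\<close> and
      then doubled, give a total error below \<open>\<epsilon>\<close>.\<close>
    have "0 < \<epsilon> / 4" using that by simp
    then obtain t where t: "norm ((transition_mat M t *v axis u 1)
        * (map_matrix cnj (transition_mat M t) *v axis u 1)
        - (1 / real CARD('n)) *\<^sub>R 1) < \<epsilon> / 4"
      using assms(4) unfolding local_eps_uniform_mixing_def by blast
    define a b where "a = norm (transition_mat M t $ u $ u)"
      and "b = norm (transition_mat M t $ v $ u)"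
    have "1 \<le> a + b"
      using norm_transition_mat_twins_diff[OF uv eig, of t] norm_triangle_ineq4
      unfolding a_def b_def by metis
    then have "1 \<le> (a + b)\<^sup>2" by (simp add: one_le_power)
    also have "\<dots> \<le> 2 * (a\<^sup>2 + b\<^sup>2)"
      using zero_le_power2[of "a - b"] by (simp add: power2_eq_square algebra_simps)
    finally show ?thesis
      using norm_square_transition_mat_close[OF t, of u] norm_square_transition_mat_close[OF t, of v]
      by (simp add: a_def b_def)
  qed
  then have "1 \<le> 4 / real CARD('n)" by (rule field_le_epsilon)
  then show ?thesis by (simp add: field_simps)
qed

end
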